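(* Let $\sigma$ be a non-decreasing sigmoidal function satisfying: $\sigma(x)-1/2$ is odd; $\sigma\in C^2(\mathbb{R})$ is concave for $x\ge0$; and $\sigma(x)=\mathcal{O}(|x|^{-1-\alpha})$ as $x\to-\infty$ for some $\alpha>1$. Let $1\le p\le+\infty$. Then there is a constant $C>0$, independent of $n$ and $f$, such that for every $f\in M(I)$ (with $f\in C(I)$ when $p=+\infty$) and all sufficiently large $n\in\mathbb{N}$ $$\|F_n(f,\cdot)-f(\cdot)\|_p\ \le\ C\,\tau(f,n^{-1/4})_p .$$
   Context: A sigmoidal function is $\sigma:\mathbb{R}\to\mathbb{R}$ with $\lim_{x\to-\infty}\sigma(x)=0$ and $\lim_{x\to+\infty}\sigma(x)=1$. Let $I=[a_1,b_1]\times[a_2,b_2]\subset\mathbb{R}^2$, and let $M(I)$ be the set of all bounded measurable functions $f:I\to\mathbb{R}$ (defined everywhere). Functions on $I$ are regarded as extended to $\mathbb{R}^2$ by periodicity in each variable. Set $\phi_\sigma(x)=\frac12[\sigma(x+1)-\sigma(x-1)]$ for $x\in\mathbb{R}$, $\Psi_\sigma(\mathtt{x})=\phi_\sigma(x_1)\phi_\sigma(x_2)$ for $\mathtt{x}=(x_1,x_2)\in\mathbb{R}^2$, and $\mathcal{A}_n=\{\mathtt{k}\in\mathbb{Z}^2:\lceil na_i\rceil\le k_i\le\lfloor nb_i\rfloor,\ i=1,2\}$. The neural network operators are $$F_n(f,\mathtt{x})=\frac{\sum_{\mathtt{k}\in\mathcal{A}_n}f(\mathtt{k}/n)\,\Psi_\sigma(n\mathtt{x}-\mathtt{k})}{\sum_{\mathtt{k}\in\mathcal{A}_n}\Psi_\sigma(n\mathtt{x}-\mathtt{k})},\qquad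 \mathtt{x}\in I,\ \mathtt{k}/n=(k_1/n,k_2/n).$$ Averaged modulus of smoothness ($\tau$-modulus): with $\|\mathtt{x}\|_m=\max_i|x_i|$, $|\mathtt{h}|=\|\mathtt{h}\|_m$ for $\mathtt{h}\in\mathbb{R}^2$, and $\Omega_{\delta/2}(\mathtt{x})=\{\mathtt{y}\in\mathbb{R}^2:\|\mathtt{y}-\mathtt{x}\|_m\le\delta/2\}$, put $$\omega(f,\mathtt{x};\delta)=\sup_{0<|\mathtt{h}|\le\delta}\{|f(\mathtt{u}+\mathtt{h})-f(\mathtt{u})|:\ \mathtt{u}+\mathtt{h},\mathtt{u}\in\Omega_{\delta/2}(\mathtt{x})\},\quad \mathtt{x}\in I,$$ and $\tau(f,\delta)_p=\|\omega(f,\cdot;\delta)\|_p$ (norm in $L^p(I)$, Lebesgue measure) for $1\le p<+\infty$. For $p=+\infty$ the $\tau$-modulus is defined for $f\in C(I)$, and $\tau(f,\delta)_\infty=\omega(f,\delta)$ is the classical modulus of continuity of $f$; $\|\cdot\|_\infty$ is the sup-norm. *)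

theory Defs
  imports "HOL-Analysis.Analysis" "HOL-Library.Landau_Symbols"
begin

definition sigmoidal :: "(real \<Rightarrow> real) \<Rightarrow> bool" where
  "sigmoidal \<sigma> \<longleftrightarrow> (\<sigma> \<longlongrightarrow> 0) at_bot \<and> (\<sigma> \<longlongrightarrow> 1) at_top"

definition C2_real :: "(real \<Rightarrow> real) \<Rightarrow> bool" where
  "C2_real g \<longleftrightarrow> g differentiable_on UNIV \<and> deriv g differentiable_on UNIV \<and>
     continuous_on UNIV (deriv (deriv g))"

definition phi :: "(real \<Rightarrow> real) \<Rightarrow> real \<Rightarrow> real" where
  "phi \<sigma> x = (1/2) * (\<sigma> (x + 1) - \<sigma> (x - 1))"

definition Psi :: "(real \<Rightarrow> real) \<Rightarrow> real^2 \<Rightarrow> real" where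
  "Psi \<sigma> x = phi \<sigma> (x$1) * phi \<sigma> (x$2)"

definition node_set :: "real^2 \<Rightarrow> real^2 \<Rightarrow> nat \<Rightarrow> (int^2) set" where
  "node_set a b n = {k. \<forall>i. \<lceil>real n * a$i\<rceil> \<le> k$i \<and> k$i \<le> \<lfloor>real n * b$i\<rfloor>}"

definition vec_of_int :: "int^2 \<Rightarrow> real^2" where
  "vec_of_int k = (\<chi> i. real_of_int (k$i))"

definition NN_op ::
  "(real \<Rightarrow> real) \<Rightarrow> real^2 \<Rightarrow> real^2 \<Rightarrow> nat \<Rightarrow> (real^2 \<Rightarrow> real) \<Rightarrow> real^2 \<Rightarrow> real" where
  "NN_op \<sigma> a b n f x =
     (\<Sum>k\<in>node_set a b n. f (vec_of_int k /\<^sub>R real n) * Psi \<sigma> (real n *\<^sub>R x - vec_of_int k)) /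
     (\<Sum>k\<in>node_set a b n. Psi \<sigma> (real n *\<^sub>R x - vec_of_int k))"

definition bounded_measurable_on :: "(real^2) set \<Rightarrow> (real^2 \<Rightarrow> real) set" where
  "bounded_measurable_on I = {f \<in> borel_measurable (lebesgue_on I). bounded (f ` I)}"

text \<open>Periodic extension from \<open>cbox a b\<close>. As \<open>f\<close> need not agree on opposite edges, a choice is
  needed: on the closed rectangle \<open>f\<close> itself is kept, and only coordinates outside
  \<open>[a$i, b$i]\<close> are moved, to their representative in \<open>[a$i, b$i)\<close>. Redefining \<open>f\<close> on
  the edges instead would not do: the operators sample \<open>f\<close> there.\<close>

definition wrap :: "real \<Rightarrow> real \<Rightarrow> real \<Rightarrow> real" where
  "wrap l r t = (if l \<le> t \<and> t \<le> r then t else l + (r - l) * frac ((t - l) / (r - l)))"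

definition periodic_ext :: "real^2 \<Rightarrow> real^2 \<Rightarrow> (real^2 \<Rightarrow> real) \<Rightarrow> real^2 \<Rightarrow> real" where
  "periodic_ext a b f x = f (\<chi> i. wrap (a$i) (b$i) (x$i))"

text \<open>On \<open>real^2\<close> the library's \<open>infnorm\<close> is the maximum norm.\<close>

definition max_cball :: "real^2 \<Rightarrow> real \<Rightarrow> (real^2) set" where
  "max_cball x r = {y. infnorm (y - x) \<le> r}"

definition local_modulus ::
  "real^2 \<Rightarrow> real^2 \<Rightarrow> (real^2 \<Rightarrow> real) \<Rightarrow> real^2 \<Rightarrow> real \<Rightarrow> real" where
  "local_modulus a b f x \<delta> =
     Sup {\<bar>periodic_ext a b f (u + h) - periodic_ext a b f u\<bar> | u h.
            0 < infnorm h \<and> infnorm h \<le> \<delta> \<and>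
            u + h \<in> max_cball x (\<delta>/2) \<and> u \<in> max_cball x (\<delta>/2)}"

definition modulus_of_continuity :: "(real^2) set \<Rightarrow> (real^2 \<Rightarrow> real) \<Rightarrow> real \<Rightarrow> real" where
  "modulus_of_continuity I f \<delta> = Sup {\<bar>f x - f y\<bar> | x y. x \<in> I \<and> y \<in> I \<and> infnorm (x - y) \<le> \<delta>}"

text \<open>Used only for bounded functions on bounded sets, where the integral is finite and the
  supremum is a genuine one. For \<open>p = \<infinity>\<close> this is the supremum, not the essential supremum.
  The measure is the completed one because suprema over closed neighbourhoods, as in
  \<open>local_modulus\<close>, need not be Borel measurable.\<close>

definition Lp_norm :: "(real^2) set \<Rightarrow> ennreal \<Rightarrow> (real^2 \<Rightarrow> real) \<Rightarrow> real" where
  "Lp_norm I p g =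
     (if p = \<infinity> then (SUP x\<in>I. \<bar>g x\<bar>)
      else enn2real (\<integral>\<^sup>+x\<in>I. ennreal (\<bar>g x\<bar> powr enn2real p) \<partial>lebesgue) powr (1 / enn2real p))"

definition tau_modulus ::
  "real^2 \<Rightarrow> real^2 \<Rightarrow> (real^2 \<Rightarrow> real) \<Rightarrow> real \<Rightarrow> ennreal \<Rightarrow> real" where
  "tau_modulus a b f \<delta> p =
     (if p = \<infinity> then modulus_of_continuity (cbox a b) f \<delta>
      else Lp_norm (cbox a b) p (\<lambda>x. local_modulus a b f x \<delta>))"

end

theory Submission
  imports Defs
begin

text \<open>
  Write \<open>\<delta> = n powr (- 1/4)\<close>. At a point \<open>x\<close> of the rectangle the error of the operator is a weighted
  mean of the differences \<open>f (k/n) - f x\<close>, and the nodes fall into two groups. For nodes within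
  \<open>\<delta>/2\<close> of \<open>x\<close> the difference is at most the local modulus of \<open>f\<close> at \<open>x\<close>, whose Lp norm is the
  averaged modulus \<open>\<tau>\<close> for finite \<open>p\<close>; for \<open>p = \<infinity>\<close> it is at most \<open>\<tau>\<close> itself.
  For the other nodes the difference is merely bounded by the oscillation of \<open>f\<close> on the whole rectangle, but
  these nodes carry very little weight.

  The weight of the far nodes is estimated without summing any decay rate: the kernel is a central
  difference of \<open>\<sigma>\<close>, so its sum over a half line of integers telescopes (\<open>sum_phi_le\<close>) and the far
  weight is \<open>O(\<sigma> (1 - n \<delta> / 2))\<close> (\<open>sum_Psi_tail\<close>). The total weight stays away from zero because
  some node lies within \<open>1/n\<close> of \<open>x\<close> in each coordinate (\<open>sum_Psi_ge\<close>). Together these give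
  \<open>NN_op_error\<close>.

  The oscillation over the rectangle is at most a constant times \<open>\<tau> / \<delta>^3\<close>
  (\<open>oscillation_le_tau_modulus\<close>). If \<open>u\<close> and \<open>v\<close> are \<open>\<delta>/4\<close> apart, then the local modulus is
  at least \<open>\<bar>f u - f v\<bar>\<close> on a whole square of side \<open>\<delta>/4\<close>, which for finite \<open>p\<close> bounds one such
  step by \<open>16 \<tau> / \<delta>^2\<close>, while for \<open>p = \<infinity>\<close> the step is at most \<open>\<tau>\<close>. Any two
  points are joined by \<open>O(1/\<delta>)\<close> steps.

  Finally \<open>1 / \<delta>^3 = n powr (3/4)\<close> is exactly the order of \<open>n \<delta>\<close>, so the decay of \<open>\<sigma>\<close> at minus
  infinity keeps the product \<open>\<sigma> (1 - n \<delta> / 2) / \<delta>^3\<close> bounded (\<open>tail_rate\<close>). The error is therefore at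
  most the local modulus plus a constant multiple of \<open>\<tau>\<close>, and taking Lp norms proves the claim
  (\<open>tau_estimate_of_pointwise\<close>). The local modulus is a supremum over an uncountable family, whose
  measurability is a delicate question. It is avoided by reading the integral of the local modulus
  as a lower integral, which is still subadditive when one summand is measurable
  (\<open>nn_integral_affine_le\<close>).
\<close>

section \<open>Lattice sums of the kernel\<close>

lemma sum_central_difference:
  fixes g :: "int \<Rightarrow> real"
  assumes "A \<le> B"
  shows "(\<Sum>k=A..B. g (k + 1) - g (k - 1)) = g (B + 1) + g B - g A - g (A - 1)"
  using assms
proof (induction B rule: int_ge_induct)
  case base
  then show ?case by simp
next
  case (step i)
  have "{A..i + 1} = insert (i + 1) {A..i}" using step by auto
  then show ?case using step by simp
qed

lemma sum_Un_le:
  fixes g :: "'a \<Rightarrow> real"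
  assumes "finite A" "finite B" "\<And>x. 0 \<le> g x"
  shows "sum g (A \<union> B) \<le> sum g A + sum g B"
proof -
  have "0 \<le> sum g (A \<inter> B)" by (simp add: sum_nonneg assms(3))
  then show ?thesis using sum.union_inter[OF assms(1,2), of g] by linarith
qed

text \<open>
  The terms are nonnegative, so \<open>S\<close> may be filled up to an interval, over which the sum telescopes:
  every value of \<open>\<sigma>\<close> cancels except two near each end of the range,
  and those lie between \<open>l\<close> and \<open>u\<close>. With \<open>l = 0\<close> and \<open>u = 1\<close> this bounds a full sum, and with
  \<open>l\<close> near 1 or \<open>u\<close> near 0 it bounds the two tails.
\<close>

lemma sum_phi_le:
  fixes S :: "int set" and t l u :: real
  assumes "mono \<sigma>" "finite S" "l \<le> u"
    and bounds: "\<And>k. k \<in> S \<Longrightarrow> l \<le> \<sigma> (t - k - 1) \<and> \<sigma> (t - k + 1) \<le> u"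
  shows "(\<Sum>k\<in>S. phi \<sigma> (t - k)) \<le> u - l"
proof (cases "S = {}")
  case True
  then show ?thesis using assms by simp
next
  case False
  define A where "A = Min S"
  define B where "B = Max S"
  have AB: "A \<in> S" "B \<in> S" "S \<subseteq> {A..B}"
    using assms False by (auto simp: A_def B_def)
  have nonneg: "0 \<le> phi \<sigma> s" for s
    using monoD[OF \<open>mono \<sigma>\<close>, of "s - 1" "s + 1"] by (simp add: phi_def)
  define g where "g k = - \<sigma> (t - real_of_int k) / 2" for k :: int
  have "(\<Sum>k\<in>S. phi \<sigma> (t - k)) \<le> (\<Sum>k=A..B. phi \<sigma> (t - k))"
    by (rule sum_mono2) (use AB nonneg in auto)
  also have "\<dots> = (\<Sum>k=A..B. g (k + 1) - g (k - 1))"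
    by (intro sum.cong) (auto simp: phi_def g_def field_simps)
  also have "\<dots> = g (B + 1) + g B - g A - g (A - 1)"
    by (rule sum_central_difference) (use AB in auto)
  also have "\<dots> \<le> u - l"
    using bounds[OF AB(1)] bounds[OF AB(2)]
      monoD[OF \<open>mono \<sigma>\<close>, of "t - A" "t - A + 1"] monoD[OF \<open>mono \<sigma>\<close>, of "t - B - 1" "t - B"]
    by (simp add: g_def algebra_simps)
  finally show ?thesis .
qed

lemma sum_int2_product:
  fixes g h :: "int \<Rightarrow> real"
  shows "(\<Sum>k\<in>{k::int^2. k$1 \<in> A \<and> k$2 \<in> B}. g (k$1) * h (k$2)) = (\<Sum>i\<in>A. g i) * (\<Sum>j\<in>B. h j)"
proof -
  have "bij_betw (\<lambda>(i,j). vector [i,j] :: int^2) (A \<times> B) {k. k$1 \<in> A \<and> k$2 \<in> B}"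
    by (rule bij_betw_byWitness[where f' = "\<lambda>k. (k$1, k$2)"]) (auto simp: vec_eq_iff forall_2)
  then have "(\<Sum>k\<in>{k::int^2. k$1 \<in> A \<and> k$2 \<in> B}. g (k$1) * h (k$2)) =
      (\<Sum>(i,j)\<in>A \<times> B. g i * h j)"
    by (subst sum.reindex_bij_betw[symmetric]) (auto simp: case_prod_unfold)
  then show ?thesis by (simp add: sum_product sum.cartesian_product)
qed

lemma finite_int2_box:
  assumes "finite A" "finite B"
  shows "finite {k::int^2. k$1 \<in> A \<and> k$2 \<in> B}"
proof (rule finite_surj)
  show "finite (A \<times> B)" using assms by simp
  show "{k::int^2. k$1 \<in> A \<and> k$2 \<in> B} \<subseteq> (\<lambda>(i,j). vector [i,j]) ` (A \<times> B)"
  proof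
    fix k :: "int^2" assume "k \<in> {k. k$1 \<in> A \<and> k$2 \<in> B}"
    moreover have "k = vector [k$1, k$2]" by (simp add: vec_eq_iff forall_2)
    ultimately show "k \<in> (\<lambda>(i,j). vector [i,j]) ` (A \<times> B)" by (metis (mono_tags, lifting) SigmaI case_prod_conv imageI mem_Collect_eq)
  qed
qed

abbreviation node_range :: "real^2 \<Rightarrow> real^2 \<Rightarrow> nat \<Rightarrow> 2 \<Rightarrow> int set" where
  "node_range a b n i \<equiv> {\<lceil>real n * a$i\<rceil>..\<lfloor>real n * b$i\<rfloor>}"

lemma node_set_eq: "node_set a b n = {k. k$1 \<in> node_range a b n 1 \<and> k$2 \<in> node_range a b n 2}"
  by (auto simp: node_set_def forall_2)

lemma finite_node_set: "finite (node_set a b n)"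
  unfolding node_set_eq by (rule finite_int2_box) auto

lemma node_in_cbox:
  assumes "k \<in> node_set a b n" "0 < n"
  shows "vec_of_int k /\<^sub>R real n \<in> cbox a b"
proof -
  have "a$i \<le> real_of_int (k$i) / n \<and> real_of_int (k$i) / n \<le> b$i" for i
    using assms by (auto simp: node_set_def field_simps ceiling_le_iff le_floor_iff)
  then show ?thesis by (simp add: mem_box_cart vec_of_int_def field_simps)
qed

text \<open>
  The hypothesis \<open>reflect\<close> is the oddness of \<open>\<sigma> - 1/2\<close>. It turns the upper tail of \<open>\<sigma>\<close> into the lower
  one, so that a single decay rate controls the kernel on both sides.
\<close>

locale centred_sigmoid =
  fixes \<sigma> :: "real \<Rightarrow> real"
  assumes mono: "mono \<sigma>" and nonneg: "0 \<le> \<sigma> x" and reflect: "\<sigma> (- x) = 1 - \<sigma> x"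
begin

lemma le_1: "\<sigma> x \<le> 1"
  using nonneg[of "- x"] reflect[of x] by simp

lemma phi_nonneg: "0 \<le> phi \<sigma> x"
  using monoD[OF mono, of "x - 1" "x + 1"] by (simp add: phi_def)

lemma Psi_nonneg: "0 \<le> Psi \<sigma> x"
  by (simp add: Psi_def phi_nonneg)

lemma sum_phi_le_1: "finite S \<Longrightarrow> (\<Sum>k\<in>S. phi \<sigma> (t - real_of_int k)) \<le> 1"
  using sum_phi_le[OF mono, of S 0 1 t] nonneg le_1 by simp

lemma sum_phi_tail:
  fixes S :: "int set" and R t :: real
  assumes "finite S"
  shows "(\<Sum>k\<in>{k\<in>S. R < \<bar>t - k\<bar>}. phi \<sigma> (t - k)) \<le> 2 * \<sigma> (1 - R)"
proof -
  have "(\<Sum>k\<in>{k\<in>S. R < \<bar>t - k\<bar>}. phi \<sigma> (t - k)) \<le>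
      (\<Sum>k\<in>{k\<in>S. R < t - k} \<union> {k\<in>S. t - k < - R}. phi \<sigma> (t - k))"
    by (rule sum_mono2) (use assms phi_nonneg in auto)
  also have "\<dots> \<le> (\<Sum>k\<in>{k\<in>S. R < t - k}. phi \<sigma> (t - k)) + (\<Sum>k\<in>{k\<in>S. t - k < - R}. phi \<sigma> (t - k))"
    by (rule sum_Un_le) (use assms phi_nonneg in auto)
  also have "(\<Sum>k\<in>{k\<in>S. R < t - k}. phi \<sigma> (t - k)) \<le> 1 - \<sigma> (R - 1)"
    by (rule sum_phi_le[OF mono]) (use assms le_1 in \<open>auto intro!: monoD[OF mono]\<close>)
  also have "(\<Sum>k\<in>{k\<in>S. t - k < - R}. phi \<sigma> (t - k)) \<le> \<sigma> (1 - R) - 0"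
    by (rule sum_phi_le[OF mono]) (use assms nonneg in \<open>auto intro!: monoD[OF mono]\<close>)
  finally show ?thesis using reflect[of "R - 1"] by simp
qed

text \<open>
  When \<open>\<bar>s\<bar> \<le> 1\<close>, one of the intervals from 0 to 1 and from -1 to 0 lies between \<open>s - 1\<close> and
  \<open>s + 1\<close>, and \<open>\<sigma>\<close> grows by \<open>\<sigma> 1 - 1/2\<close> on each of them.
\<close>

lemma phi_ge:
  assumes "\<bar>s\<bar> \<le> 1"
  shows "(\<sigma> 1 - 1/2) / 2 \<le> phi \<sigma> s"
proof (cases "0 \<le> s")
  case True
  then have "\<sigma> 1 \<le> \<sigma> (s + 1)" "\<sigma> (s - 1) \<le> \<sigma> 0" using assms by (auto intro!: monoD[OF mono])
  then show ?thesis using reflect[of 0] by (simp add: phi_def)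
next
  case False
  then have "\<sigma> 0 \<le> \<sigma> (s + 1)" "\<sigma> (s - 1) \<le> \<sigma> (- 1)" using assms by (auto intro!: monoD[OF mono])
  then show ?thesis using reflect[of 0] reflect[of 1] by (simp add: phi_def)
qed

text \<open>
  A concave function that has not increased between 0 and 1 never increases later, so \<open>\<sigma>\<close> could
  not reach its limit 1.
\<close>

lemma half_less_1:
  assumes "concave_on {0..} \<sigma>" "(\<sigma> \<longlongrightarrow> 1) at_top"
  shows "1/2 < \<sigma> 1"
proof (rule ccontr)
  assume "\<not> 1/2 < \<sigma> 1"
  have "\<sigma> x \<le> 1/2" if "1 \<le> x" for x
  proof -
    have "(1 - 1/x) * \<sigma> 0 + (1/x) * \<sigma> x \<le> \<sigma> ((1 - 1/x) *\<^sub>R 0 + (1/x) *\<^sub>R x)"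
      using that by (intro concave_onD[OF assms(1)]) auto
    also have "\<dots> \<le> 1/2" using that \<open>\<not> 1/2 < \<sigma> 1\<close> by simp
    finally show ?thesis using that reflect[of 0] by (simp add: field_simps)
  qed
  then have "\<forall>\<^sub>F x in at_top. \<sigma> x \<le> 1/2" by (intro eventually_mono[OF eventually_ge_at_top[of 1]])
  then have "(1::real) \<le> 1/2" using assms(2) by (intro tendsto_upperbound) auto
  then show False by simp
qed

text \<open>
  A single node suffices: one that is at distance at most \<open>1/n\<close> from \<open>x\<close> in both coordinates.
  The hypothesis on \<open>n\<close> makes sure that rounding does not leave the rectangle.
\<close>

lemma sum_Psi_ge:
  assumes x: "x \<in> cbox a b" and n: "\<And>i. 1 \<le> real n * (b$i - a$i)"
  shows "((\<sigma> 1 - 1/2) / 2)\<^sup>2 \<le> (\<Sum>k\<in>node_set a b n. Psi \<sigma> (real n *\<^sub>R x - vec_of_int k))"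
proof -
  have "\<exists>k. k \<in> node_range a b n i \<and> \<bar>real n * x$i - real_of_int k\<bar> \<le> 1" for i
  proof (cases "\<lceil>real n * a$i\<rceil> \<le> \<lfloor>real n * x$i\<rfloor>")
    case True
    have "real n * x$i \<le> real n * b$i"
      using x by (auto simp: mem_box_cart intro!: mult_left_mono)
    then show ?thesis using True
      by (intro exI[of _ "\<lfloor>real n * x$i\<rfloor>"]) (auto simp: floor_mono, linarith)
  next
    case False
    have "real n * a$i \<le> real n * x$i"
      using x by (auto simp: mem_box_cart intro!: mult_left_mono)
    moreover have "real n * a$i + 1 \<le> real n * b$i"
      using n[of i] by (simp add: algebra_simps)
    ultimately show ?thesis using False
      by (intro exI[of _ "\<lceil>real n * a$i\<rceil>"]) (auto, linarith+)
  qed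
  then obtain k1 k2 where k: "k1 \<in> node_range a b n 1" "\<bar>real n * x$1 - real_of_int k1\<bar> \<le> 1"
      "k2 \<in> node_range a b n 2" "\<bar>real n * x$2 - real_of_int k2\<bar> \<le> 1"
    by metis
  define k where "k = (vector [k1, k2] :: int^2)"
  have pos: "0 \<le> (\<sigma> 1 - 1/2) / 2"
    using monoD[OF mono, of 0 1] reflect[of 0] by simp
  have "((\<sigma> 1 - 1/2) / 2)\<^sup>2 \<le> Psi \<sigma> (real n *\<^sub>R x - vec_of_int k)"
    unfolding Psi_def power2_eq_square
    using pos k by (intro mult_mono phi_ge phi_nonneg) (simp_all add: k_def vec_of_int_def)
  also have "\<dots> \<le> (\<Sum>k\<in>node_set a b n. Psi \<sigma> (real n *\<^sub>R x - vec_of_int k))"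
    by (rule member_le_sum[OF _ Psi_nonneg finite_node_set]) (use k in \<open>auto simp: node_set_eq k_def\<close>)
  finally show ?thesis .
qed

text \<open>
  A far node is far in at least one coordinate; the sum over the other coordinate is at most 1.
\<close>

lemma sum_Psi_tail:
  "(\<Sum>k\<in>{k\<in>node_set a b n. R < infnorm (y - vec_of_int k)}. Psi \<sigma> (y - vec_of_int k)) \<le> 4 * \<sigma> (1 - R)"
proof -
  let ?J = "node_range a b n"
  define T where "T i = {k \<in> ?J i. R < \<bar>y$i - real_of_int k\<bar>}" for i
  define E1 where "E1 = {k::int^2. k$1 \<in> T 1 \<and> k$2 \<in> ?J 2}"
  define E2 where "E2 = {k::int^2. k$1 \<in> ?J 1 \<and> k$2 \<in> T 2}"
  let ?P = "\<lambda>k. Psi \<sigma> (y - vec_of_int k)"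
  have fin: "finite E1" "finite E2"
    unfolding E1_def E2_def T_def by (intro finite_int2_box finite_atLeastAtMost_int finite_Collect_conjI disjI1; simp)+
  have prod: "(\<Sum>k\<in>{k. k$1 \<in> A \<and> k$2 \<in> B}. ?P k) =
      (\<Sum>i\<in>A. phi \<sigma> (y$1 - real_of_int i)) * (\<Sum>j\<in>B. phi \<sigma> (y$2 - real_of_int j))" for A B
    unfolding sum_int2_product[symmetric] by (simp add: Psi_def vec_of_int_def)
  have tail: "(\<Sum>k\<in>T i. phi \<sigma> (y$i - real_of_int k)) \<le> 2 * \<sigma> (1 - R)" for i
    unfolding T_def by (rule sum_phi_tail) simp
  have full: "(\<Sum>k\<in>?J i. phi \<sigma> (y$i - real_of_int k)) \<le> 1" for i
    by (rule sum_phi_le_1) simp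
  have "(\<Sum>k\<in>{k\<in>node_set a b n. R < infnorm (y - vec_of_int k)}. ?P k) \<le> sum ?P (E1 \<union> E2)"
    by (rule sum_mono2)
      (use fin Psi_nonneg in \<open>auto simp: node_set_eq E1_def E2_def T_def infnorm_2 vec_of_int_def less_max_iff_disj\<close>)
  also have "\<dots> \<le> sum ?P E1 + sum ?P E2"
    by (rule sum_Un_le) (use fin Psi_nonneg in auto)
  also have "sum ?P E1 \<le> (2 * \<sigma> (1 - R)) * 1"
    unfolding E1_def prod by (rule mult_mono[OF tail full]) (auto simp: nonneg phi_nonneg sum_nonneg)
  also have "sum ?P E2 \<le> 1 * (2 * \<sigma> (1 - R))"
    unfolding E2_def prod by (rule mult_mono[OF full tail]) (auto simp: nonneg phi_nonneg sum_nonneg)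
  finally show ?thesis by simp
qed

section \<open>Pointwise error of the operators\<close>

text \<open>
  Nodes within \<open>r\<close> of \<open>x\<close> contribute at most \<open>W\<close> times their share of the total weight, and the
  remaining ones at most \<open>G\<close> times the tail weight divided by the lower bound of the total weight.
\<close>

lemma NN_op_error:
  assumes x: "x \<in> cbox a b" and n: "\<And>i. 1 \<le> real n * (b$i - a$i)" "0 < n"
    and gap: "1/2 < \<sigma> 1"
    and near: "\<And>y. y \<in> cbox a b \<Longrightarrow> infnorm (y - x) \<le> r \<Longrightarrow> \<bar>f y - f x\<bar> \<le> W"
    and global: "\<And>y. y \<in> cbox a b \<Longrightarrow> \<bar>f y - f x\<bar> \<le> G"
    and "0 \<le> W"
  shows "\<bar>NN_op \<sigma> a b n f x - f x\<bar> \<le> W + 16 / (\<sigma> 1 - 1/2)\<^sup>2 * \<sigma> (1 - real n * r) * G"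
proof -
  let ?N = "node_set a b n" and ?P = "\<lambda>k. Psi \<sigma> (real n *\<^sub>R x - vec_of_int k)"
  let ?y = "\<lambda>k. vec_of_int k /\<^sub>R real n"
  define D where "D = sum ?P ?N"
  define c where "c = ((\<sigma> 1 - 1/2) / 2)\<^sup>2"
  \<comment> \<open>The far nodes; scaling by \<open>n\<close> turns the distance \<open>r\<close> into \<open>n r\<close>.\<close>
  define F where "F = {k\<in>?N. real n * r < infnorm (real n *\<^sub>R x - vec_of_int k)}"
  have c: "0 < c" using gap by (simp add: c_def)
  have D: "c \<le> D" unfolding c_def D_def by (rule sum_Psi_ge) (use x n in auto)
  have G: "0 \<le> G" using global[OF x] by simp
  have FN: "F \<subseteq> ?N" "finite F" "finite (?N - F)"
    using finite_node_set by (auto simp: F_def)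
  have nearby: "\<bar>f (?y k) - f x\<bar> \<le> W" if "k \<in> ?N - F" for k
  proof (rule near)
    show "?y k \<in> cbox a b" using that node_in_cbox n by auto
    have "infnorm (real n *\<^sub>R x - vec_of_int k) = real n * infnorm (x - ?y k)"
      using infnorm_mul[of "real n" "x - ?y k"] n(2) by (simp add: algebra_simps)
    moreover have "infnorm (real n *\<^sub>R x - vec_of_int k) \<le> real n * r"
      using that by (auto simp: F_def)
    ultimately show "infnorm (?y k - x) \<le> r"
      using n(2) by (simp add: infnorm_sub)
  qed
  have "D * (NN_op \<sigma> a b n f x - f x) = (\<Sum>k\<in>?N. (f (?y k) - f x) * ?P k)"
    using D c by (simp add: NN_op_def D_def[symmetric] right_diff_distrib left_diff_distrib sum_subtractf
        sum_distrib_left[symmetric] mult.commute)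
  then have "D * \<bar>NN_op \<sigma> a b n f x - f x\<bar> = \<bar>\<Sum>k\<in>?N. (f (?y k) - f x) * ?P k\<bar>"
    using D c by (metis abs_mult abs_of_pos order_less_le_trans)
  also have "\<dots> \<le> (\<Sum>k\<in>?N. \<bar>f (?y k) - f x\<bar> * ?P k)"
    by (rule order_trans[OF sum_abs]) (simp add: abs_mult Psi_nonneg)
  also have "\<dots> = (\<Sum>k\<in>?N - F. \<bar>f (?y k) - f x\<bar> * ?P k) + (\<Sum>k\<in>F. \<bar>f (?y k) - f x\<bar> * ?P k)"
    by (rule sum.subset_diff) (use FN finite_node_set in auto)
  also have "(\<Sum>k\<in>?N - F. \<bar>f (?y k) - f x\<bar> * ?P k) \<le> (\<Sum>k\<in>?N - F. W * ?P k)"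
    by (intro sum_mono mult_right_mono nearby) (auto simp: Psi_nonneg)
  also have "(\<Sum>k\<in>?N - F. W * ?P k) \<le> W * D"
    unfolding D_def sum_distrib_left[symmetric]
    by (intro mult_left_mono sum_mono2) (use finite_node_set Psi_nonneg \<open>0 \<le> W\<close> in auto)
  also have "(\<Sum>k\<in>F. \<bar>f (?y k) - f x\<bar> * ?P k) \<le> (\<Sum>k\<in>F. G * ?P k)"
    by (intro sum_mono mult_right_mono global) (use FN node_in_cbox n in \<open>auto simp: Psi_nonneg\<close>)
  also have "(\<Sum>k\<in>F. G * ?P k) \<le> G * (4 * \<sigma> (1 - real n * r))"
    unfolding F_def sum_distrib_left[symmetric] by (intro mult_left_mono sum_Psi_tail G)
  finally have "\<bar>NN_op \<sigma> a b n f x - f x\<bar> \<le> (W * D + G * (4 * \<sigma> (1 - real n * r))) / D"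
    using D c by (simp add: pos_le_divide_eq mult.commute)
  also have "\<dots> = W + G * (4 * \<sigma> (1 - real n * r)) / D"
    using D c by (simp add: add_divide_distrib)
  also have "\<dots> \<le> W + G * (4 * \<sigma> (1 - real n * r)) / c"
    by (intro add_left_mono divide_left_mono) (use D c G nonneg in auto)
  also have "\<dots> = W + 16 / (\<sigma> 1 - 1/2)\<^sup>2 * \<sigma> (1 - real n * r) * G"
    by (simp add: c_def power_divide)
  finally show ?thesis .
qed

end

section \<open>Periodic extension and local moduli\<close>

lemma wrap_mem:
  assumes "l < r"
  shows "l \<le> wrap l r t \<and> wrap l r t \<le> r"
proof -
  have "(r - l) * frac ((t - l) / (r - l)) \<le> (r - l) * 1"
    using assms by (intro mult_left_mono) (auto intro: less_imp_le frac_lt_1)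
  moreover have "0 \<le> (r - l) * frac ((t - l) / (r - l))"
    using assms by simp
  ultimately show ?thesis by (auto simp: wrap_def)
qed

lemma periodic_ext_eq: "x \<in> cbox a b \<Longrightarrow> periodic_ext a b f x = f x"
  by (simp add: periodic_ext_def wrap_def mem_box_cart)

lemma periodic_ext_le:
  assumes "\<And>i. a$i < b$i" "\<And>x. x \<in> cbox a b \<Longrightarrow> \<bar>f x\<bar> \<le> B"
  shows "\<bar>periodic_ext a b f x\<bar> \<le> B"
  unfolding periodic_ext_def by (rule assms(2)) (simp add: mem_box_cart wrap_mem[OF assms(1)])

text \<open>
  The supremum defining the local modulus ranges over a set that is bounded, as \<open>f\<close> is bounded, and
  nonempty, as \<open>\<delta>\<close> is positive. Hence it is a genuine supremum and dominates all pairs of points,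
  including the excluded increment \<open>h = 0\<close>.
\<close>

lemma local_modulus_bounds:
  assumes ab: "\<And>i. a$i < b$i" and B: "\<And>x. x \<in> cbox a b \<Longrightarrow> \<bar>f x\<bar> \<le> B" and "0 < \<delta>"
  shows local_modulus_ge: "\<And>u v. u \<in> max_cball x (\<delta>/2) \<Longrightarrow> v \<in> max_cball x (\<delta>/2) \<Longrightarrow>
      \<bar>periodic_ext a b f u - periodic_ext a b f v\<bar> \<le> local_modulus a b f x \<delta>"
    and local_modulus_nonneg: "0 \<le> local_modulus a b f x \<delta>"
    and local_modulus_le: "local_modulus a b f x \<delta> \<le> 2 * B"
proof -
  define D where "D = {\<bar>periodic_ext a b f (u + h) - periodic_ext a b f u\<bar> | u h.
            0 < infnorm h \<and> infnorm h \<le> \<delta> \<and>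
            u + h \<in> max_cball x (\<delta>/2) \<and> u \<in> max_cball x (\<delta>/2)}"
  have lm: "local_modulus a b f x \<delta> = Sup D" by (simp add: local_modulus_def D_def)
  have le: "d \<le> 2 * B" if "d \<in> D" for d
  proof -
    obtain u h where "d = \<bar>periodic_ext a b f (u + h) - periodic_ext a b f u\<bar>"
      using \<open>d \<in> D\<close> unfolding D_def by blast
    moreover have "\<bar>periodic_ext a b f y\<bar> \<le> B" for y by (rule periodic_ext_le[OF ab B])
    from this[of "u + h"] this[of u] have "\<bar>periodic_ext a b f (u + h) - periodic_ext a b f u\<bar> \<le> 2 * B"
      by linarith
    ultimately show ?thesis by simp
  qed
  have bdd: "bdd_above D" by (rule bdd_aboveI[OF le])
  have mem: "\<bar>periodic_ext a b f u - periodic_ext a b f v\<bar> \<in> D"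
    if "u \<in> max_cball x (\<delta>/2)" "v \<in> max_cball x (\<delta>/2)" "u \<noteq> v" for u v
  proof -
    have "infnorm (u - v) \<le> infnorm (u - x) + infnorm (x - v)"
      using infnorm_triangle[of "u - x" "x - v"] by simp
    then have "infnorm (u - v) \<le> \<delta>" "0 < infnorm (u - v)"
      using that by (auto simp: max_cball_def infnorm_sub infnorm_pos_lt)
    then show ?thesis using that unfolding D_def
      by (intro CollectI exI[of _ v] exI[of _ "u - v"]) auto
  qed
  \<comment> \<open>The point \<open>e\<close> witnesses that the set of increments is nonempty.\<close>
  define e where "e = x + vec (\<delta>/2)"
  have e: "e \<in> max_cball x (\<delta>/2)" "x \<in> max_cball x (\<delta>/2)" "e \<noteq> x"
    using \<open>0 < \<delta>\<close> by (auto simp: max_cball_def infnorm_2 e_def vec_eq_iff)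
  have D0: "D \<noteq> {}" using mem[OF e] by auto
  have "0 \<le> \<bar>periodic_ext a b f e - periodic_ext a b f x\<bar>" by simp
  also have "\<dots> \<le> Sup D" by (rule cSup_upper[OF mem[OF e] bdd])
  finally show nonneg: "0 \<le> local_modulus a b f x \<delta>" by (simp add: lm)
  show "local_modulus a b f x \<delta> \<le> 2 * B" unfolding lm by (rule cSup_least[OF D0 le])
  show "\<bar>periodic_ext a b f u - periodic_ext a b f v\<bar> \<le> local_modulus a b f x \<delta>"
    if "u \<in> max_cball x (\<delta>/2)" "v \<in> max_cball x (\<delta>/2)" for u v
    using cSup_upper[OF mem[OF that] bdd] nonneg by (cases "u = v") (auto simp: lm)
qed

section \<open>Lp norms as lower integrals\<close>

text \<open>
  Subadditivity of the integral as a supremum over simple functions, for an arbitrary \<open>h\<close>. A simple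
  \<open>g\<close> below \<open>k h + c\<close> gives the measurable function \<open>(g - c) / k\<close> below \<open>h\<close>, to which additivity
  applies.
\<close>

lemma nn_integral_affine_le:
  fixes k :: real and h c :: "'a \<Rightarrow> ennreal"
  assumes k: "0 < k" and c: "c \<in> borel_measurable M"
  shows "(\<integral>\<^sup>+x. ennreal k * h x + c x \<partial>M) \<le> ennreal k * (\<integral>\<^sup>+x. h x \<partial>M) + (\<integral>\<^sup>+x. c x \<partial>M)"
proof -
  have k1: "ennreal k * (ennreal (1 / k) * t) = t" "ennreal (1 / k) * (ennreal k * t) = t" for t
    using k by (simp_all add: mult.assoc[symmetric] ennreal_mult[symmetric])
  have "integral\<^sup>S M g \<le> ennreal k * (\<integral>\<^sup>+x. h x \<partial>M) + (\<integral>\<^sup>+x. c x \<partial>M)"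
    if g: "simple_function M g" "g \<le> (\<lambda>x. ennreal k * h x + c x)" "\<forall>x. g x < top" for g
  proof -
    define s where "s x = ennreal (1 / k) * (g x - c x)" for x
    have gm: "g \<in> borel_measurable M" by (rule borel_measurable_simple_function[OF g(1)])
    then have s: "s \<in> borel_measurable M" unfolding s_def using c by simp
    have sh: "s x \<le> h x" for x
    proof -
      have "g x - c x \<le> ennreal k * h x"
        using le_funD[OF g(2), of x] g(3)[rule_format, of x]
        by (auto simp: ennreal_minus_le_iff add.commute)
      then have "s x \<le> ennreal (1 / k) * (ennreal k * h x)" unfolding s_def by (rule mult_left_mono) simp
      then show ?thesis by (simp add: k1)
    qed
    have gs: "g x \<le> ennreal k * s x + c x" for x
    proof (cases "c x \<le> g x")
      case True
      then show ?thesis by (simp add: s_def k1 diff_add_cancel_ennreal)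
    next
      case False
      then show ?thesis by (simp add: add_increasing)
    qed
    have "integral\<^sup>S M g = (\<integral>\<^sup>+x. g x \<partial>M)" by (simp add: nn_integral_eq_simple_integral g(1))
    also have "\<dots> \<le> (\<integral>\<^sup>+x. ennreal k * s x + c x \<partial>M)" by (intro nn_integral_mono gs)
    also have "\<dots> = ennreal k * (\<integral>\<^sup>+x. s x \<partial>M) + (\<integral>\<^sup>+x. c x \<partial>M)"
      using s c by (simp add: nn_integral_add nn_integral_cmult)
    also have "\<dots> \<le> ennreal k * (\<integral>\<^sup>+x. h x \<partial>M) + (\<integral>\<^sup>+x. c x \<partial>M)"
      by (intro add_right_mono mult_left_mono nn_integral_mono sh) auto
    finally show ?thesis .
  qed
  then show ?thesis unfolding nn_integral_def_finite[of M "\<lambda>x. ennreal k * h x + c x"]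
    by (intro SUP_least) auto
qed

lemma one_le_enn2real:
  assumes "1 \<le> p" "p \<noteq> \<infinity>"
  shows "1 \<le> enn2real p"
  using assms by (metis enn2real_1 enn2real_mono infinity_ennreal_def less_top)

lemma Lp_norm_nonneg: "p \<noteq> \<infinity> \<Longrightarrow> 0 \<le> Lp_norm I p g"
  by (simp add: Lp_norm_def)

lemma Lp_integral_finite:
  assumes I: "I \<in> lmeasurable" and W: "\<And>x. x \<in> I \<Longrightarrow> \<bar>W x\<bar> \<le> B" and "0 \<le> P"
  shows "(\<integral>\<^sup>+x\<in>I. ennreal (\<bar>W x\<bar> powr P) \<partial>lebesgue) < top"
proof -
  have "(\<integral>\<^sup>+x\<in>I. ennreal (\<bar>W x\<bar> powr P) \<partial>lebesgue) \<le> (\<integral>\<^sup>+x. ennreal (\<bar>B\<bar> powr P) * indicator I x \<partial>lebesgue)"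
    by (intro nn_integral_mono) (use W \<open>0 \<le> P\<close> in \<open>force simp: indicator_def intro!: ennreal_leI powr_mono2\<close>)
  also have "\<dots> = ennreal (\<bar>B\<bar> powr P) * emeasure lebesgue I"
    using I by (simp add: nn_integral_cmult_indicator fmeasurableD)
  also have "\<dots> < top"
    unfolding emeasure_eq_measure2[OF I] by (simp add: ennreal_mult[symmetric])
  finally show ?thesis .
qed

text \<open>
  A substitute for Minkowski's inequality when \<open>W\<close> need not be measurable. It rests on
  \<open>(s + t) powr p \<le> 2 powr p * (s powr p + t powr p)\<close>; since the added constant is itself a multiple
  of the norm of \<open>W\<close>, that norm factors out.
\<close>

lemma Lp_norm_le_of_pointwise:
  assumes I: "I \<in> lmeasurable" and p: "1 \<le> p" "p \<noteq> \<infinity>" and "0 \<le> M"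
    and W: "\<And>x. x \<in> I \<Longrightarrow> 0 \<le> W x \<and> W x \<le> B"
    and g: "\<And>x. x \<in> I \<Longrightarrow> \<bar>g x\<bar> \<le> W x + M * Lp_norm I p W"
  shows "Lp_norm I p g \<le>
     2 * (1 + M powr enn2real p * measure lebesgue I) powr (1 / enn2real p) * Lp_norm I p W"
proof -
  define P where "P = enn2real p"
  have P: "1 \<le> P" unfolding P_def by (rule one_le_enn2real[OF p])
  define J where "J h = (\<integral>\<^sup>+x\<in>I. ennreal (\<bar>h x\<bar> powr P) \<partial>lebesgue)" for h :: "real^2 \<Rightarrow> real"
  define T where "T = enn2real (J W)"
  have JW: "J W = ennreal T"
    using Lp_integral_finite[OF I, of W B P] W P unfolding T_def J_def by (simp add: less_top)
  have norm: "Lp_norm I p h = enn2real (J h) powr (1 / P)" for h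
    using p by (simp add: Lp_norm_def J_def P_def)
  have T: "0 \<le> T" by (simp add: T_def)
  define c where "c = M * T powr (1 / P)"
  have c: "0 \<le> c" using \<open>0 \<le> M\<close> by (simp add: c_def)
  have cP: "c powr P = M powr P * T"
    using P T \<open>0 \<le> M\<close> by (simp add: c_def powr_mult powr_powr)
  have pt: "\<bar>g x\<bar> powr P \<le> 2 powr P * (\<bar>W x\<bar> powr P) + 2 powr P * c powr P" if "x \<in> I" for x
  proof -
    have "\<bar>g x\<bar> powr P \<le> (2 * max (W x) c) powr P"
      using g[OF that] P by (intro powr_mono2) (auto simp: norm c_def T_def)
    also have "\<dots> = 2 powr P * max (W x) c powr P" using c by (simp add: powr_mult)
    also have "max (W x) c powr P \<le> W x powr P + c powr P" by (simp add: max_def)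
    finally show ?thesis using W[OF that] by (simp add: distrib_left)
  qed
  have "J g \<le> (\<integral>\<^sup>+x. ennreal (2 powr P) * (ennreal (\<bar>W x\<bar> powr P) * indicator I x)
      + ennreal (2 powr P * c powr P) * indicator I x \<partial>lebesgue)"
    unfolding J_def
    by (intro nn_integral_mono)
       (auto simp: indicator_def ennreal_mult[symmetric] ennreal_plus[symmetric] pt simp del: ennreal_plus intro!: ennreal_leI)
  also have "\<dots> \<le> ennreal (2 powr P) * J W + (\<integral>\<^sup>+x. ennreal (2 powr P * c powr P) * indicator I x \<partial>lebesgue)"
    unfolding J_def by (rule nn_integral_affine_le) (use I in \<open>auto simp: fmeasurableD\<close>)
  also have "\<dots> = ennreal (2 powr P * T + 2 powr P * c powr P * measure lebesgue I)"
    using I T by (simp add: JW nn_integral_cmult_indicator fmeasurableD emeasure_eq_measure2 ennreal_mult ennreal_plus)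
  also have "2 powr P * T + 2 powr P * c powr P * measure lebesgue I
      = 2 powr P * (1 + M powr P * measure lebesgue I) * T"
    by (simp add: cP algebra_simps)
  finally have "enn2real (J g) \<le> 2 powr P * (1 + M powr P * measure lebesgue I) * T"
    using T by (intro enn2real_leI) auto
  then have "enn2real (J g) powr (1 / P) \<le> (2 powr P * (1 + M powr P * measure lebesgue I) * T) powr (1 / P)"
    using P by (intro powr_mono2) auto
  also have "\<dots> = 2 * (1 + M powr P * measure lebesgue I) powr (1 / P) * T powr (1 / P)"
    using P T by (simp add: powr_mult powr_powr)
  finally show ?thesis by (simp add: norm T_def P_def)
qed

section \<open>Global oscillation in terms of the averaged modulus\<close>

text \<open>
  If \<open>u\<close> and \<open>v\<close> differ by at most \<open>\<delta>/4\<close>, they both lie in the window of half-width \<open>\<delta>/2\<close>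
  around every point within \<open>\<delta>/4\<close> of \<open>u\<close>. The rectangle contains a square of side \<open>\<delta>/4\<close> of such
  points, and on it the local modulus is at least \<open>\<bar>f u - f v\<bar>\<close>.
\<close>

lemma step_le_Lp_norm_local_modulus:
  assumes ab: "\<And>i. a$i < b$i" and B: "\<And>x. x \<in> cbox a b \<Longrightarrow> \<bar>f x\<bar> \<le> B"
    and \<delta>: "0 < \<delta>" "\<delta> \<le> 1" "\<And>i. \<delta> / 2 \<le> b$i - a$i"
    and p: "1 \<le> p" "p \<noteq> \<infinity>"
    and uv: "u \<in> cbox a b" "v \<in> cbox a b" "infnorm (u - v) \<le> \<delta> / 4"
  shows "\<bar>f u - f v\<bar> \<le> 16 / \<delta>\<^sup>2 * Lp_norm (cbox a b) p (\<lambda>x. local_modulus a b f x \<delta>)"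
proof -
  define P where "P = enn2real p"
  have P: "1 \<le> P" unfolding P_def by (rule one_le_enn2real[OF p])
  let ?W = "\<lambda>x. local_modulus a b f x \<delta>"
  define J where "J = (\<integral>\<^sup>+x\<in>cbox a b. ennreal (\<bar>?W x\<bar> powr P) \<partial>lebesgue)"
  define T where "T = enn2real J"
  define d where "d = \<bar>f u - f v\<bar>"
  have "J < top" unfolding J_def
    using local_modulus_nonneg[OF ab B \<delta>(1)] local_modulus_le[OF ab B \<delta>(1)] P
    by (intro Lp_integral_finite[where B = "2 * B"]) auto
  then have J: "J = ennreal T" by (simp add: T_def)
  have "0 \<le> T" by (simp add: T_def)
  \<comment> \<open>The square reaches from \<open>u\<close> to the right in each coordinate where there is room, else to the left.\<close>
  define l where "l = (\<chi> i. if u$i + \<delta>/4 \<le> b$i then u$i else u$i - \<delta>/4)"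
  define Q where "Q = cbox l (l + vec (\<delta>/4))"
  have l: "a$i \<le> l$i" "l$i + \<delta>/4 \<le> b$i" "u$i - \<delta>/4 \<le> l$i" "l$i \<le> u$i" for i
  proof -
    have "a$i \<le> u$i" "u$i \<le> b$i" using uv by (auto simp: mem_box_cart)
    then show "a$i \<le> l$i" "l$i + \<delta>/4 \<le> b$i" "u$i - \<delta>/4 \<le> l$i" "l$i \<le> u$i"
      using \<delta>(1) \<delta>(3)[of i] by (auto simp: l_def)
  qed
  have zQ: "z \<in> cbox a b \<and> infnorm (z - u) \<le> \<delta> / 4" if "z \<in> Q" for z
  proof -
    have z: "l$i \<le> z$i" "z$i \<le> l$i + \<delta>/4" for i using that by (auto simp: Q_def mem_box_cart)
    have "a$i \<le> z$i \<and> z$i \<le> b$i" "\<bar>z$i - u$i\<bar> \<le> \<delta>/4" for i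
      using z[of i] l[of i] by linarith+
    then show ?thesis by (simp add: mem_box_cart infnorm_2 del: le_divide_eq_numeral1)
  qed
  have dW: "d \<le> ?W z" if "z \<in> Q" for z
  proof -
    have "infnorm (v - z) \<le> infnorm (v - u) + infnorm (u - z)"
      using infnorm_triangle[of "v - u" "u - z"] by simp
    then have "u \<in> max_cball z (\<delta>/2)" "v \<in> max_cball z (\<delta>/2)"
      using zQ[OF that] uv(3) \<delta>(1) by (auto simp: max_cball_def infnorm_sub)
    from local_modulus_ge[OF ab B \<delta>(1) this] show ?thesis
      using uv by (simp add: d_def periodic_ext_eq)
  qed
  have "measure lborel Q = (\<delta>/4)\<^sup>2"
    using \<delta>(1) unfolding Q_def by (subst content_cbox_cart) (auto simp: interval_ne_empty_cart UNIV_2 power2_eq_square)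
  then have mQ: "emeasure lebesgue Q = ennreal ((\<delta>/4)\<^sup>2)"
    by (simp add: Q_def emeasure_eq_measure2)
  have "Q \<in> sets lebesgue" by (simp add: Q_def)
  then have "ennreal (d powr P * (\<delta>/4)\<^sup>2) = (\<integral>\<^sup>+x. ennreal (d powr P) * indicator Q x \<partial>lebesgue)"
    by (simp only: nn_integral_cmult_indicator mQ) (simp add: ennreal_mult)
  also have "\<dots> \<le> J" unfolding J_def
  proof (intro nn_integral_mono)
    fix x
    show "ennreal (d powr P) * indicator Q x \<le> ennreal (\<bar>?W x\<bar> powr P) * indicator (cbox a b) x"
      using zQ[of x] dW[of x] P
      by (cases "x \<in> Q") (auto simp: d_def intro!: ennreal_leI powr_mono2)
  qed
  finally have "d powr P * (\<delta>/4)\<^sup>2 \<le> T"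
    using \<open>0 \<le> T\<close> by (simp add: J)
  then have "d powr P \<le> 16 / \<delta>\<^sup>2 * T" using \<delta>(1) by (simp add: field_simps)
  then have "(d powr P) powr (1/P) \<le> (16 / \<delta>\<^sup>2 * T) powr (1/P)" using P by (intro powr_mono2) auto
  also have "\<dots> = (16 / \<delta>\<^sup>2) powr (1/P) * T powr (1/P)" using \<open>0 \<le> T\<close> by (subst powr_mult) auto
  also have "\<dots> \<le> (16 / \<delta>\<^sup>2) powr 1 * T powr (1/P)"
  proof (intro mult_right_mono powr_mono)
    have "\<delta>\<^sup>2 \<le> 1" using \<delta> by (simp add: power_le_one)
    then show "1 \<le> 16 / \<delta>\<^sup>2" using \<delta>(1) by (simp add: field_simps)
  qed (use P in auto)
  finally show ?thesis
    using P p \<delta>(1) by (simp add: powr_powr d_def Lp_norm_def T_def J_def P_def)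
qed

lemma modulus_of_continuity_ge:
  assumes "bounded (f ` I)" "x \<in> I" "y \<in> I" "infnorm (x - y) \<le> \<delta>"
  shows "\<bar>f x - f y\<bar> \<le> modulus_of_continuity I f \<delta>"
proof -
  obtain B where B: "\<And>x. x \<in> I \<Longrightarrow> \<bar>f x\<bar> \<le> B"
    using assms(1) by (auto simp: bounded_iff)
  have "bdd_above {\<bar>f x - f y\<bar> | x y. x \<in> I \<and> y \<in> I \<and> infnorm (x - y) \<le> \<delta>}"
  proof (rule bdd_aboveI[of _ "2 * B"], clarify)
    fix x y assume "x \<in> I" "y \<in> I"
    then show "\<bar>f x - f y\<bar> \<le> 2 * B" using B[of x] B[of y] by linarith
  qed
  then show ?thesis unfolding modulus_of_continuity_def
    by (rule cSup_upper[rotated]) (use assms in auto)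
qed

text \<open>
  The segment from \<open>x\<close> to \<open>y\<close> stays in \<open>S\<close> and is cut into \<open>N\<close> equal steps.
\<close>

lemma chain_bound:
  fixes f :: "'a::euclidean_space \<Rightarrow> real"
  assumes "convex S" "x \<in> S" "y \<in> S" "infnorm (x - y) \<le> real N * \<eta>"
    and step: "\<And>u v. u \<in> S \<Longrightarrow> v \<in> S \<Longrightarrow> infnorm (u - v) \<le> \<eta> \<Longrightarrow> \<bar>f u - f v\<bar> \<le> E"
  shows "\<bar>f x - f y\<bar> \<le> real N * E"
  using assms(2,4)
proof (induction N arbitrary: x)
  case 0
  then have "x = y" using infnorm_pos_lt[of "x - y"] by auto
  then show ?case by simp
next
  case (Suc N)
  define t where "t = 1 / (real N + 1)"
  define z where "z = (1 - t) *\<^sub>R x + t *\<^sub>R y"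
  have t: "0 \<le> t" "t \<le> 1" "1 - t = real N * t" by (auto simp: t_def field_simps)
  have "z \<in> S"
    unfolding z_def using Suc.prems assms(1,3) t by (intro convexD_alt) auto
  have small: "t * infnorm (x - y) \<le> \<eta>"
    using Suc.prems(2) by (simp add: t_def field_simps)
  have "x - z = t *\<^sub>R (x - y)" "z - y = (1 - t) *\<^sub>R (x - y)"
    by (auto simp: z_def algebra_simps)
  then have "infnorm (x - z) = t * infnorm (x - y)" "infnorm (z - y) = real N * (t * infnorm (x - y))"
    using t by (auto simp: infnorm_mul)
  then have "infnorm (x - z) \<le> \<eta>" "infnorm (z - y) \<le> real N * \<eta>"
    using small by (auto intro: mult_left_mono)
  then have "\<bar>f x - f z\<bar> \<le> E" "\<bar>f z - f y\<bar> \<le> real N * E"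
    using step Suc.IH Suc.prems(1) \<open>z \<in> S\<close> by auto
  then show ?case by (simp add: algebra_simps)
qed

lemma tau_modulus_nonneg:
  assumes "bounded (f ` cbox a b)" "cbox a b \<noteq> {}" "0 \<le> \<delta>"
  shows "0 \<le> tau_modulus a b f \<delta> p"
proof (cases "p = \<infinity>")
  case True
  obtain x where "x \<in> cbox a b" using assms(2) by auto
  then have "\<bar>f x - f x\<bar> \<le> modulus_of_continuity (cbox a b) f \<delta>"
    using assms by (intro modulus_of_continuity_ge) (auto simp: infnorm_0)
  then show ?thesis using True by (simp add: tau_modulus_def)
qed (simp add: tau_modulus_def Lp_norm_nonneg)

lemma step_le_tau_modulus:
  assumes ab: "\<And>i. a$i < b$i" and f: "bounded (f ` cbox a b)"
    and \<delta>: "0 < \<delta>" "\<delta> \<le> 1" "\<And>i. \<delta> / 2 \<le> b$i - a$i" and "1 \<le> p"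
    and uv: "u \<in> cbox a b" "v \<in> cbox a b" "infnorm (u - v) \<le> \<delta> / 4"
  shows "\<bar>f u - f v\<bar> \<le> 16 / \<delta>\<^sup>2 * tau_modulus a b f \<delta> p"
proof (cases "p = \<infinity>")
  case True
  have "\<bar>f u - f v\<bar> \<le> 1 * tau_modulus a b f \<delta> p"
    using True f uv \<delta>(1) by (auto simp: tau_modulus_def intro!: modulus_of_continuity_ge)
  also have "\<dots> \<le> 16 / \<delta>\<^sup>2 * tau_modulus a b f \<delta> p"
  proof (intro mult_right_mono tau_modulus_nonneg f)
    have "\<delta>\<^sup>2 \<le> 1" using \<delta> by (simp add: power_le_one)
    then show "1 \<le> 16 / \<delta>\<^sup>2" using \<delta>(1) by (simp add: field_simps)
  qed (use uv \<delta> in auto)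
  finally show ?thesis .
next
  case False
  obtain B where "\<And>x. x \<in> cbox a b \<Longrightarrow> \<bar>f x\<bar> \<le> B"
    using f by (auto simp: bounded_iff)
  from step_le_Lp_norm_local_modulus[OF ab this \<delta> \<open>1 \<le> p\<close> False uv] show ?thesis
    using False by (simp add: tau_modulus_def)
qed

lemma oscillation_le_tau_modulus:
  assumes ab: "\<And>i. a$i < b$i" and f: "bounded (f ` cbox a b)"
    and \<delta>: "0 < \<delta>" "\<delta> \<le> 1" "\<And>i. \<delta> / 2 \<le> b$i - a$i" and "1 \<le> p"
    and xy: "x \<in> cbox a b" "y \<in> cbox a b"
  shows "\<bar>f x - f y\<bar> \<le> 16 * (4 * infnorm (b - a) + 1) / \<delta>^3 * tau_modulus a b f \<delta> p"
proof -
  define L where "L = infnorm (b - a)"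
  define N where "N = nat \<lceil>4 * L / \<delta>\<rceil>"
  let ?E = "16 / \<delta>\<^sup>2 * tau_modulus a b f \<delta> p"
  have L: "0 \<le> L" by (simp add: L_def infnorm_pos_le)
  have "0 \<le> 4 * L / \<delta>" using L \<delta>(1) by simp
  then have N: "4 * L / \<delta> \<le> real N" "real N \<le> 4 * L / \<delta> + 1"
    unfolding N_def by linarith+
  have E: "0 \<le> ?E"
    using xy \<delta>(1) by (intro mult_nonneg_nonneg tau_modulus_nonneg f) auto
  have "\<bar>(x - y)$i\<bar> \<le> L" for i
    using xy component_le_infnorm_cart[of "b - a" i] by (auto simp: mem_box_cart L_def abs_le_iff dest!: spec[of _ i])
  then have "infnorm (x - y) \<le> L" by (simp add: infnorm_2)
  also have "L \<le> real N * (\<delta> / 4)" using N(1) \<delta>(1) by (simp add: field_simps)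
  finally have "\<bar>f x - f y\<bar> \<le> real N * ?E"
    by (rule chain_bound[OF convex_box(1) xy _ step_le_tau_modulus[OF ab f \<delta> \<open>1 \<le> p\<close>]])
  also have "\<dots> \<le> ((4 * L + 1) / \<delta>) * ?E"
  proof (rule mult_right_mono[OF _ E])
    have "1 \<le> 1 / \<delta>" using \<delta> by simp
    then show "real N \<le> (4 * L + 1) / \<delta>" using N(2) unfolding add_divide_distrib by linarith
  qed
  finally show ?thesis by (simp add: L_def power2_eq_square power3_eq_cube mult_ac)
qed

section \<open>The rate of convergence\<close>

text \<open>
  The weight \<open>\<sigma> (1 - s)\<close> of the nodes at scaled distance more than \<open>s\<close> beats the factor \<open>s\<close>
  contributed by the global oscillation.
\<close>

lemma tail_rate:
  fixes \<sigma> :: "real \<Rightarrow> real" and s :: "nat \<Rightarrow> real"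
  assumes "\<sigma> \<in> O[at_bot](\<lambda>x. \<bar>x\<bar> powr (- 1 - \<alpha>))" "0 \<le> \<alpha>" and s: "filterlim s at_top sequentially"
  obtains K where "0 < K" "\<forall>\<^sub>F n in sequentially. \<sigma> (1 - s n) * s n \<le> K"
proof -
  obtain c where c: "0 < c" "\<forall>\<^sub>F x in at_bot. norm (\<sigma> x) \<le> c * norm (\<bar>x\<bar> powr (- 1 - \<alpha>))"
    using assms(1) by (elim landau_o.bigE)
  have "filterlim (\<lambda>n. - (- 1 + s n)) at_bot sequentially"
    using s by (simp only: filterlim_uminus_at_bot minus_minus) (intro filterlim_tendsto_add_at_top[OF tendsto_const])
  then have "filterlim (\<lambda>n. 1 - s n) at_bot sequentially" by simp
  from eventually_compose_filterlim[OF c(2) this]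
  have "\<forall>\<^sub>F n in sequentially. norm (\<sigma> (1 - s n)) \<le> c * norm (\<bar>1 - s n\<bar> powr (- 1 - \<alpha>))" .
  moreover have "\<forall>\<^sub>F n in sequentially. 2 \<le> s n"
    using s by (simp add: filterlim_at_top)
  ultimately have "\<forall>\<^sub>F n in sequentially. \<sigma> (1 - s n) * s n \<le> 2 * c"
  proof eventually_elim
    case (elim n)
    have "\<bar>1 - s n\<bar> powr (- 1 - \<alpha>) \<le> \<bar>1 - s n\<bar> powr (- 1)"
      using elim(2) \<open>0 \<le> \<alpha>\<close> by (intro powr_mono) auto
    also have "\<dots> = 1 / (s n - 1)" using elim(2) by (simp add: powr_minus_divide)
    also have "\<dots> \<le> 2 / s n" using elim(2) by (simp add: field_simps)
    finally have "c * norm (\<bar>1 - s n\<bar> powr (- 1 - \<alpha>)) \<le> c * (2 / s n)"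
      using c(1) by (intro mult_left_mono) auto
    then have "\<sigma> (1 - s n) \<le> c * (2 / s n)" using elim(1) by simp
    then have "\<sigma> (1 - s n) * s n \<le> c * (2 / s n) * s n"
      using elim(2) by (intro mult_right_mono) auto
    then show ?case using elim(2) by (simp add: mult.commute)
  qed
  then show ?thesis using that[of "2 * c"] c(1) by simp
qed

text \<open>
  The hypothesis on \<open>g\<close> asks for an error bound with any admissible bound \<open>W\<close> on the differences near
  \<open>x\<close>. This lets \<open>W\<close> be the modulus of continuity for \<open>p = \<infinity>\<close> and the local modulus at \<open>x\<close>
  for finite \<open>p\<close>, so that the operators are treated once for all \<open>p\<close>.
\<close>

lemma tau_estimate_of_pointwise:
  assumes ab: "\<And>i. a$i < b$i" and f: "bounded (f ` cbox a b)" and "0 < \<delta>" "1 \<le> p" "0 \<le> M"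
    and g: "\<And>x W. x \<in> cbox a b \<Longrightarrow> 0 \<le> W \<Longrightarrow>
      (\<And>y. y \<in> cbox a b \<Longrightarrow> infnorm (y - x) \<le> \<delta> / 2 \<Longrightarrow> \<bar>f y - f x\<bar> \<le> W) \<Longrightarrow>
      \<bar>g x\<bar> \<le> W + M * tau_modulus a b f \<delta> p"
  shows "Lp_norm (cbox a b) p g \<le>
     (if p = \<infinity> then 1 + M
      else 2 * (1 + M powr enn2real p * measure lebesgue (cbox a b)) powr (1 / enn2real p))
     * tau_modulus a b f \<delta> p"
proof (cases "p = \<infinity>")
  case True
  let ?w = "modulus_of_continuity (cbox a b) f \<delta>"
  have tau: "tau_modulus a b f \<delta> p = ?w" using True by (simp add: tau_modulus_def)
  have ne: "cbox a b \<noteq> {}" using ab by (simp add: interval_ne_empty_cart less_imp_le)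
  have "\<bar>g x\<bar> \<le> (1 + M) * ?w" if "x \<in> cbox a b" for x
  proof -
    have "\<bar>g x\<bar> \<le> ?w + M * tau_modulus a b f \<delta> p"
    proof (rule g[OF that])
      show "0 \<le> ?w" using tau_modulus_nonneg[OF f ne, of \<delta> p] \<open>0 < \<delta>\<close> tau by simp
    qed (use that \<open>0 < \<delta>\<close> in \<open>auto intro!: modulus_of_continuity_ge[OF f]\<close>)
    then show ?thesis by (simp add: tau algebra_simps)
  qed
  then have "(SUP x\<in>cbox a b. \<bar>g x\<bar>) \<le> (1 + M) * ?w" by (rule cSUP_least[OF ne])
  then show ?thesis unfolding tau using True by (simp add: Lp_norm_def)
next
  case False
  obtain B where B: "\<And>x. x \<in> cbox a b \<Longrightarrow> \<bar>f x\<bar> \<le> B"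
    using f by (auto simp: bounded_iff)
  let ?W = "\<lambda>x. local_modulus a b f x \<delta>"
  have tau: "tau_modulus a b f \<delta> p = Lp_norm (cbox a b) p ?W" using False by (simp add: tau_modulus_def)
  have W: "0 \<le> ?W x" "?W x \<le> 2 * B" for x
    by (rule local_modulus_nonneg[OF ab B \<open>0 < \<delta>\<close>] local_modulus_le[OF ab B \<open>0 < \<delta>\<close>]; assumption)+
  have "\<bar>g x\<bar> \<le> ?W x + M * Lp_norm (cbox a b) p ?W" if x: "x \<in> cbox a b" for x
    unfolding tau[symmetric]
  proof (rule g[OF x W(1)])
    fix y assume y: "y \<in> cbox a b" "infnorm (y - x) \<le> \<delta> / 2"
    then have "y \<in> max_cball x (\<delta>/2)" "x \<in> max_cball x (\<delta>/2)"
      using \<open>0 < \<delta>\<close> by (auto simp: max_cball_def infnorm_0)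
    from local_modulus_ge[OF ab B \<open>0 < \<delta>\<close> this] show "\<bar>f y - f x\<bar> \<le> ?W x"
      using x y by (simp add: periodic_ext_eq)
  qed
  from Lp_norm_le_of_pointwise[OF _ \<open>1 \<le> p\<close> False \<open>0 \<le> M\<close>, of "cbox a b" ?W "2 * B" g, OF _ _ this]
  show ?thesis using W False by (simp add: tau)
qed

theorem theorem17:
  fixes \<sigma> :: "real \<Rightarrow> real" and a b :: "real^2" and \<alpha> :: real and p :: ennreal
  assumes "\<forall>i. a$i < b$i"
    and "mono \<sigma>"
    and "sigmoidal \<sigma>"
    and "\<forall>x. \<sigma> (- x) - 1/2 = - (\<sigma> x - 1/2)"
    and "C2_real \<sigma>"
    and "concave_on {0..} \<sigma>"
    and "\<alpha> > 1"
    and "\<sigma> \<in> O[at_bot](\<lambda>x. \<bar>x\<bar> powr (- 1 - \<alpha>))"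
    and "1 \<le> p"
  shows "\<exists>C>0. \<forall>\<^sub>F n in sequentially. \<forall>f \<in> bounded_measurable_on (cbox a b).
           (p = \<infinity> \<longrightarrow> continuous_on (cbox a b) f) \<longrightarrow>
           Lp_norm (cbox a b) p (\<lambda>x. NN_op \<sigma> a b n f x - f x)
             \<le> C * tau_modulus a b f (real n powr (- 1/4)) p"
proof -
  have ab: "a$i < b$i" for i using assms(1) by simp
  have lim: "(\<sigma> \<longlongrightarrow> 0) at_bot" "(\<sigma> \<longlongrightarrow> 1) at_top"
    using assms(3) by (auto simp: sigmoidal_def)
  interpret centred_sigmoid \<sigma>
  proof
    fix x
    have "\<forall>\<^sub>F y in at_bot. \<sigma> y \<le> \<sigma> x"
      by (rule eventually_mono[OF eventually_le_at_bot[of x]]) (rule monoD[OF assms(2)])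
    then show "0 \<le> \<sigma> x" using lim(1) by (intro tendsto_upperbound) auto
    show "\<sigma> (- x) = 1 - \<sigma> x" using assms(4)[rule_format, of x] by simp
  qed (rule assms(2))
  have gap: "1/2 < \<sigma> 1" by (rule half_less_1[OF assms(6) lim(2)])
  define \<delta> where "\<delta> n = real n powr (- 1/4)" for n
  \<comment> \<open>The radius of the near window, measured in the scaled lattice.\<close>
  define s where "s n = real n * (\<delta> n / 2)" for n
  have two_s: "2 * s n = real n powr (3/4)" if "0 < n" for n
    using that powr_add[of "real n" 1 "- 1/4"] by (simp add: s_def \<delta>_def)
  have s_eq: "1 / \<delta> n ^ 3 = 2 * s n" if "0 < n" for n
  proof -
    have "\<delta> n ^ 3 * real n powr (3/4) = 1"
      using that by (simp add: \<delta>_def powr_realpow[symmetric] powr_powr powr_add[symmetric])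
    then show ?thesis unfolding two_s[OF that] by (metis mult_eq_0_iff nonzero_eq_divide_eq one_neq_zero mult.commute)
  qed
  have \<delta>0: "\<delta> \<longlonglongrightarrow> 0"
    unfolding \<delta>_def by (intro tendsto_neg_powr filterlim_real_sequentially) simp
  have s: "filterlim s at_top sequentially"
  proof -
    have "(\<lambda>n. \<delta> n ^ 3) \<longlonglongrightarrow> 0" using tendsto_power[OF \<delta>0, of 3] by simp
    moreover have "\<forall>\<^sub>F n in sequentially. 0 < \<delta> n ^ 3"
      using eventually_gt_at_top[of 0] by eventually_elim (simp add: \<delta>_def)
    ultimately have "filterlim (\<lambda>n. 1/2 * inverse (\<delta> n ^ 3)) at_top sequentially"
      by (intro filterlim_tendsto_pos_mult_at_top[OF tendsto_const] filterlim_inverse_at_top) auto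
    moreover have "\<forall>\<^sub>F n in sequentially. 1/2 * inverse (\<delta> n ^ 3) = s n"
      using eventually_gt_at_top[of 0] by eventually_elim (simp add: inverse_eq_divide s_eq)
    ultimately show ?thesis by (simp cong: filterlim_cong)
  qed
  obtain K where K: "0 < K" "\<forall>\<^sub>F n in sequentially. \<sigma> (1 - s n) * s n \<le> K"
    using tail_rate[OF assms(8) _ s] assms(7) by auto
  define L where "L = infnorm (b - a)"
  \<comment> \<open>The factor \<open>16 (4 L + 1) / \<delta>^3\<close> is the global oscillation per unit of \<open>\<tau>\<close>; as \<open>1 / \<delta>^3 = 2 s\<close>,
    its product with the weight \<open>\<sigma> (1 - s)\<close> is bounded through \<open>K\<close>.\<close>
  define M where "M = 16 / (\<sigma> 1 - 1/2)\<^sup>2 * (16 * (4 * L + 1) * (2 * K))"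
  have L: "0 \<le> L" by (simp add: L_def infnorm_pos_le)
  have M: "0 \<le> M" using L K(1) by (simp add: M_def)
  define C where "C = (if p = \<infinity> then 1 + M
      else 2 * (1 + M powr enn2real p * measure lebesgue (cbox a b)) powr (1 / enn2real p))"
  have "0 < 1 + M powr enn2real p * measure lebesgue (cbox a b)"
    by (intro add_pos_nonneg mult_nonneg_nonneg) auto
  then have "0 < C" using M by (simp add: C_def)
  define m where "m = min (b$1 - a$1) (b$2 - a$2)"
  have m: "0 < m" "m \<le> b$i - a$i" for i
    using ab exhaust_2[of i] by (auto simp: m_def)
  have "\<forall>\<^sub>F n in sequentially. \<delta> n < min 1 m"
    using m(1) by (intro order_tendstoD[OF \<delta>0]) auto
  moreover have "filterlim (\<lambda>n. real n * m) at_top sequentially"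
    using m(1) by (intro filterlim_at_top_mult_tendsto_pos[OF tendsto_const] filterlim_real_sequentially)
  then have "\<forall>\<^sub>F n in sequentially. 1 \<le> real n * m" by (simp add: filterlim_at_top)
  ultimately have "\<forall>\<^sub>F n in sequentially. \<forall>f \<in> bounded_measurable_on (cbox a b).
           Lp_norm (cbox a b) p (\<lambda>x. NN_op \<sigma> a b n f x - f x) \<le> C * tau_modulus a b f (\<delta> n) p"
    using K(2) eventually_gt_at_top[of 0]
  proof eventually_elim
    case (elim n)
    have \<delta>: "0 < \<delta> n" "\<delta> n \<le> 1" "\<delta> n / 2 \<le> b$i - a$i" for i
      using elim m(1) m(2)[of i] by (auto simp: \<delta>_def)
    have n: "1 \<le> real n * (b$i - a$i)" for i
      using elim(2) m(2)[of i] by (meson mult_left_mono of_nat_0_le_iff order_trans)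
    show ?case
    proof
      fix f assume "f \<in> bounded_measurable_on (cbox a b)"
      then have f: "bounded (f ` cbox a b)" by (simp add: bounded_measurable_on_def)
      let ?\<tau> = "tau_modulus a b f (\<delta> n) p"
      let ?G = "16 * (4 * L + 1) / \<delta> n ^ 3 * ?\<tau>"
      show "Lp_norm (cbox a b) p (\<lambda>x. NN_op \<sigma> a b n f x - f x) \<le> C * ?\<tau>"
        unfolding C_def
      proof (rule tau_estimate_of_pointwise[OF ab f \<delta>(1) assms(9) M])
        fix x W
        assume x: "x \<in> cbox a b" and W: "0 \<le> W"
          and near: "\<And>y. y \<in> cbox a b \<Longrightarrow> infnorm (y - x) \<le> \<delta> n / 2 \<Longrightarrow> \<bar>f y - f x\<bar> \<le> W"
        have "\<bar>NN_op \<sigma> a b n f x - f x\<bar> \<le> W + 16 / (\<sigma> 1 - 1/2)\<^sup>2 * \<sigma> (1 - s n) * ?G"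
          unfolding s_def L_def
          by (rule NN_op_error[OF x n elim(4) gap _ _ W])
            (simp_all only: near oscillation_le_tau_modulus[OF ab f \<delta> assms(9) _ x])
        also have "16 / (\<sigma> 1 - 1/2)\<^sup>2 * \<sigma> (1 - s n) * ?G =
            16 / (\<sigma> 1 - 1/2)\<^sup>2 * (16 * (4 * L + 1) * (2 * (\<sigma> (1 - s n) * s n))) * ?\<tau>"
        proof -
          have "?G = 16 * (4 * L + 1) * (2 * s n) * ?\<tau>"
            unfolding s_eq[OF elim(4), symmetric] by simp
          then show ?thesis by (simp only: mult_ac)
        qed
        also have "\<dots> \<le> M * ?\<tau>"
          unfolding M_def
        proof (intro mult_right_mono mult_left_mono)
          show "0 \<le> ?\<tau>" using x \<delta>(1) by (intro tau_modulus_nonneg f) auto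
        qed (use elim(3) L in auto)
        finally show "\<bar>NN_op \<sigma> a b n f x - f x\<bar> \<le> W + M * ?\<tau>" by simp
      qed
    qed
  qed
  then have "\<forall>\<^sub>F n in sequentially. \<forall>f \<in> bounded_measurable_on (cbox a b).
           (p = \<infinity> \<longrightarrow> continuous_on (cbox a b) f) \<longrightarrow>
           Lp_norm (cbox a b) p (\<lambda>x. NN_op \<sigma> a b n f x - f x)
             \<le> C * tau_modulus a b f (real n powr (- 1/4)) p"
    unfolding \<delta>_def by (rule eventually_mono) blast
  with \<open>0 < C\<close> show ?thesis by blast
qed

end
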